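(* Let $n$ be a positive even integer. Then $\rho(n,n)=\left(\left(\tfrac n2\right)!\right)^4$. Furthermore, for $BT\in\mathcal{D}_n$ one has ${\rm per}(A_{BT})=\rho(n,n)$ if and only if $BT$ is isomorphic to $BT_0(n,n)$.
   Context: $K_{n,n}$ is the complete bipartite graph with parts $X=\{x_1,\dots,x_n\}$ and $Y=\{y_1,\dots,y_n\}$. $\mathcal{D}_n$ is the set of all bipartite tournaments of size $n$ by $n$, i.e. all digraphs obtained from $K_{n,n}$ by assigning a direction to each edge. $A_{BT}$ is the $(0,1)$ adjacency matrix of $BT$, of order $2n$, ${\rm per}$ is the permanent, and $\rho(n,n):=\max_{BT\in\mathcal{D}_n}{\rm per}(A_{BT})$. For even $n$, $BT_0(n,n)$ is the bipartite tournament in which all edges between $\{x_1,\dots,x_{n/2}\}$ and $\{y_1,\dots,y_{n/2}\}$ and all edges between $\{x_{n/2+1},\dots,x_n\}$ and $\{y_{n/2+1},\dots,y_n\}$ are directed from $X$ to $Y$, and all other edges (between the first half of one part and the second half of the other part) are directed from $Y$ to $X$. *)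

theory Defs
  imports
    "Jordan_Normal_Form.Matrix"
    "HOL-Combinatorics.Permutations"
    "Graph_Theory.Graph_Theory"
begin

definition permanent :: "'a::comm_semiring_1 mat \<Rightarrow> 'a" where
  "permanent A = (if dim_row A = dim_col A
     then (\<Sum>p \<in> {p. p permutes {0..<dim_row A}}. \<Prod>i = 0..<dim_row A. A $$ (i, p i))
     else 0)"

datatype bvertex = X nat | Y nat

text \<open>As usual in \<^theory>\<open>Graph_Theory.Digraph\<close>, an undirected graph is a symmetric digraph: an edge
  is a pair of opposite arcs.\<close>

definition complete_bipartite :: "nat \<Rightarrow> bvertex pair_pre_digraph" where
  "complete_bipartite n =
     \<lparr> pverts = X ` {1..n} \<union> Y ` {1..n},
       parcs = (X ` {1..n}) \<times> (Y ` {1..n}) \<union> (Y ` {1..n}) \<times> (X ` {1..n}) \<rparr>"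

text \<open>An orientation keeps exactly one of the two opposite arcs of each edge.\<close>

definition orientation :: "'a pair_pre_digraph \<Rightarrow> 'a pair_pre_digraph \<Rightarrow> bool" where
  "orientation G D \<longleftrightarrow> pverts D = pverts G \<and> parcs D \<subseteq> parcs G \<and>
     (\<forall>(u, v) \<in> parcs G. (u, v) \<in> parcs D \<longleftrightarrow> (v, u) \<notin> parcs D)"

definition bipartite_tournaments :: "nat \<Rightarrow> bvertex pair_pre_digraph set" where
  "bipartite_tournaments n = {BT. orientation (complete_bipartite n) BT}"

text \<open>Rows and columns are indexed from 0, in the order \<open>x\<^sub>1, \<dots>, x\<^sub>n, y\<^sub>1, \<dots>, y\<^sub>n\<close>.\<close>

definition nth_vertex :: "nat \<Rightarrow> nat \<Rightarrow> bvertex" where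
  "nth_vertex n i = (if i < n then X (i + 1) else Y (i - n + 1))"

definition adjacency_matrix :: "nat \<Rightarrow> bvertex pair_pre_digraph \<Rightarrow> nat mat" where
  "adjacency_matrix n BT = mat (2 * n) (2 * n)
     (\<lambda>(i, j). if (nth_vertex n i, nth_vertex n j) \<in> parcs BT then 1 else 0)"

definition rho :: "nat \<Rightarrow> nat" where
  "rho n = Max ((\<lambda>BT. permanent (adjacency_matrix n BT)) ` bipartite_tournaments n)"

definition BT0 :: "nat \<Rightarrow> bvertex pair_pre_digraph" where
  "BT0 n = (let A = {1..n div 2}; B = {n div 2 + 1..n} in
     \<lparr> pverts = X ` {1..n} \<union> Y ` {1..n},
       parcs = (X ` A) \<times> (Y ` A) \<union> (X ` B) \<times> (Y ` B) \<union>
               (Y ` A) \<times> (X ` B) \<union> (Y ` B) \<times> (X ` A) \<rparr>)"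

lemma complete_bipartite_digraph: "K\<^bsub>n,n\<^esub> (with_proj (complete_bipartite n))"
  unfolding complete_bipartite_digraph_pair_def
  by (intro conjI exI[of _ "X ` {1..n}"] exI[of _ "Y ` {1..n}"])
     (auto simp: complete_bipartite_def card_image inj_on_def)

lemma finite_bipartite_tournaments: "finite (bipartite_tournaments n)"
proof (rule finite_subset)
  let ?K = "complete_bipartite n"
  show "bipartite_tournaments n \<subseteq>
      (\<lambda>E. \<lparr> pverts = pverts ?K, parcs = E \<rparr>) ` Pow (parcs ?K)"
    by (auto simp: bipartite_tournaments_def orientation_def image_iff
        intro!: bexI[where x = "parcs _"] pair_pre_digraph.equality)
  show "finite ((\<lambda>E. \<lparr> pverts = pverts ?K, parcs = E \<rparr>) ` Pow (parcs ?K))"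
    by (simp add: complete_bipartite_def)
qed

lemma BT0_in_bipartite_tournaments: "BT0 n \<in> bipartite_tournaments n"
proof -
  have X: "X i \<in> X ` S \<longleftrightarrow> i \<in> S" and Y: "Y i \<in> Y ` S \<longleftrightarrow> i \<in> S"
    and XY: "X i \<notin> Y ` S" and YX: "Y i \<notin> X ` S" for i S
    by auto
  let ?K = "complete_bipartite n" and ?B = "BT0 n"
  have "(u, v) \<in> parcs ?B \<longleftrightarrow> (v, u) \<notin> parcs ?B" if "(u, v) \<in> parcs ?K" for u v
    using that
    by (cases u; cases v)
       (auto simp add: complete_bipartite_def BT0_def Let_def X Y XY YX)
  moreover have "parcs ?B \<subseteq> parcs ?K"
    unfolding complete_bipartite_def BT0_def Let_def pair_pre_digraph.simps
    by (intro Un_least order.trans[OF Sigma_mono[OF image_mono image_mono] Un_upper1]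
        order.trans[OF Sigma_mono[OF image_mono image_mono] Un_upper2]) auto
  moreover have pv: "pverts ?B = pverts ?K"
    by (simp add: complete_bipartite_def BT0_def Let_def)
  ultimately show ?thesis
    by (auto simp: bipartite_tournaments_def orientation_def pv)
qed

end

theory Submission
  imports Defs
begin

text \<open>With \<open>M\<close> the 0-1 matrix of the arcs from \<open>X\<close> to \<open>Y\<close>, the permanent of a bipartite tournament is
  \<open>per M \<cdot> per (J - M)\<close>. Bregman's theorem bounds each factor by the product over the rows of
  \<open>(r!) powr (1/r)\<close>, where \<open>r\<close> is the row sum, and strict concavity of \<open>ln (r!) / r\<close> shows that the
  contribution of a row with sums \<open>r\<close> and \<open>n - r\<close> is largest exactly for \<open>r = n/2\<close>. In the equality
  case of Bregman's theorem any two rows have equal or disjoint supports; with all row sums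
  \<open>n/2\<close> this leaves two complementary supports, each shared by half of the rows, which is
  \<open>BT\<^sub>0(n,n)\<close>.\<close>

section \<open>Matchings and permanents\<close>

text \<open>Uniqueness needs every equality case, so the bounds are kept as identities: with
  \<open>m = n/2\<close>, the difference \<open>4 ln (m!) - ln (per M * per (J - M))\<close> is
  exactly two Bregman defects plus one concavity defect per row, and a Bregman defect is, up to a
  factor, exactly a sum of entropy defects and Bregman defects of minors. All summands are
  nonnegative, so in the extremal case each one vanishes. The fourth power comes from
  \<open>2m\<close> rows with two factors \<open>(m!) powr (1/m)\<close> each. Permanents are
  counted as matchings between arbitrary finite sets, because the induction deletes single rows and
  columns; the vertices of a digraph can then serve as indices directly. Two conventions need care.
  Since \<open>ln 0 = 0\<close>, vanishing permanents are treated apart. The conventional value 0 of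
  \<open>ln (r!) / r\<close> at \<open>r = 0\<close> breaks concavity, which does no harm because
  two nonzero permanents exclude empty and full rows.\<close>

definition matchings :: "'a set \<Rightarrow> 'b set \<Rightarrow> ('a \<Rightarrow> 'b set) \<Rightarrow> ('a \<Rightarrow> 'b) set" where
  "matchings I J E = {f \<in> extensional I. bij_betw f I J \<and> (\<forall>i\<in>I. f i \<in> E i)}"

text \<open>The permanent of the 0-1 matrix with rows \<open>I\<close>, columns \<open>J\<close> and
  row supports \<open>E i \<inter> J\<close>. The sets \<open>E i\<close> may leave
  \<open>J\<close>, so a minor is obtained by shrinking \<open>I\<close> and \<open>J\<close> while
  \<open>E\<close> stays the same. Extensionality keeps values outside \<open>I\<close> from
  inflating the count.\<close>

definition num_matchings :: "'a set \<Rightarrow> 'b set \<Rightarrow> ('a \<Rightarrow> 'b set) \<Rightarrow> nat" where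
  "num_matchings I J E = card (matchings I J E)"

lemma matchingsD:
  assumes "f \<in> matchings I J E"
  shows "f \<in> extensional I" "bij_betw f I J" "i \<in> I \<Longrightarrow> f i \<in> E i" "i \<in> I \<Longrightarrow> f i \<in> J"
  using assms by (auto simp: matchings_def bij_betw_def)

lemma matchingsI:
  assumes "f \<in> extensional I" "bij_betw f I J" "\<And>i. i \<in> I \<Longrightarrow> f i \<in> E i"
  shows "f \<in> matchings I J E"
  using assms by (auto simp: matchings_def)

lemma finite_matchings:
  assumes "finite I" "finite J"
  shows "finite (matchings I J E)"
proof (rule finite_subset)
  show "matchings I J E \<subseteq> I \<rightarrow>\<^sub>E J"
    by (auto simp: matchings_def bij_betw_def PiE_def)
qed (use assms in \<open>simp add: finite_PiE\<close>)

lemma num_matchings_pos_iff: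
  assumes "finite I" "finite J"
  shows "0 < num_matchings I J E \<longleftrightarrow> matchings I J E \<noteq> {}"
  using finite_matchings[OF assms] by (simp add: num_matchings_def card_gt_0_iff)

text \<open>Conjugation by the relabellings is injective on matchings. The one-sided form is enough,
  since the inverse relabellings give the other inequality.\<close>

lemma num_matchings_reindex_le:
  assumes fin: "finite I" "finite J" and \<phi>: "bij_betw \<phi> I I'" and \<psi>: "bij_betw \<psi> J J'"
    and E: "\<And>i j. i \<in> I \<Longrightarrow> j \<in> J \<Longrightarrow> j \<in> E i \<Longrightarrow> \<psi> j \<in> E' (\<phi> i)"
  shows "num_matchings I J E \<le> num_matchings I' J' E'"
  unfolding num_matchings_def
proof (rule card_inj_on_le)
  let ?T = "\<lambda>f. \<lambda>x\<in>I'. \<psi> (f (inv_into I \<phi> x))"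
  have inv: "inv_into I \<phi> (\<phi> i) = i" "\<phi> i \<in> I'" if "i \<in> I" for i
    using \<phi> that by (auto simp: bij_betw_def inv_into_f_f)
  show "inj_on ?T (matchings I J E)"
  proof (rule inj_onI)
    fix f g assume f: "f \<in> matchings I J E" and g: "g \<in> matchings I J E" and eq: "?T f = ?T g"
    show "f = g"
    proof (rule extensionalityI[OF matchingsD(1)[OF f] matchingsD(1)[OF g]])
      fix i assume i: "i \<in> I"
      have "\<psi> (f i) = \<psi> (g i)"
        using fun_cong[OF eq, of "\<phi> i"] inv[OF i] by simp
      then show "f i = g i"
        using \<psi> matchingsD(4)[OF f i] matchingsD(4)[OF g i] by (auto simp: bij_betw_def dest: inj_onD)
    qed
  qed
  show "?T ` matchings I J E \<subseteq> matchings I' J' E'"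
  proof (intro image_subsetI matchingsI)
    fix f assume f: "f \<in> matchings I J E"
    have "bij_betw (\<psi> \<circ> f \<circ> inv_into I \<phi>) I' J'"
      by (intro bij_betw_trans[OF bij_betw_inv_into[OF \<phi>]] bij_betw_trans[OF matchingsD(2)[OF f] \<psi>]
          | simp add: comp_assoc)+
    then show "bij_betw (?T f) I' J'"
      by (rule bij_betw_cong[THEN iffD1, rotated]) simp
    fix x assume x: "x \<in> I'"
    then have i: "inv_into I \<phi> x \<in> I" "\<phi> (inv_into I \<phi> x) = x"
      using \<phi> by (auto simp: bij_betw_def inv_into_into f_inv_into_f)
    show "?T f x \<in> E' x"
      using E[OF i(1) matchingsD(4,3)[OF f i(1)]] i x by simp
  qed simp
  show "finite (matchings I' J' E')"
    using fin bij_betw_finite[OF \<phi>] bij_betw_finite[OF \<psi>] by (intro finite_matchings) auto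
qed

lemma num_matchings_reindex:
  assumes fin: "finite I" "finite J" and \<phi>: "bij_betw \<phi> I I'" and \<psi>: "bij_betw \<psi> J J'"
    and E: "\<And>i j. i \<in> I \<Longrightarrow> j \<in> J \<Longrightarrow> j \<in> E i \<longleftrightarrow> \<psi> j \<in> E' (\<phi> i)"
  shows "num_matchings I J E = num_matchings I' J' E'"
proof (rule antisym)
  show "num_matchings I J E \<le> num_matchings I' J' E'"
    using assms by (intro num_matchings_reindex_le) auto
  have inv\<phi>: "inv_into I \<phi> x \<in> I" "\<phi> (inv_into I \<phi> x) = x" if "x \<in> I'" for x
    using \<phi> that by (auto simp: bij_betw_def inv_into_into f_inv_into_f)
  have inv\<psi>: "inv_into J \<psi> x \<in> J" "\<psi> (inv_into J \<psi> x) = x" if "x \<in> J'" for x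
    using \<psi> that by (auto simp: bij_betw_def inv_into_into f_inv_into_f)
  show "num_matchings I' J' E' \<le> num_matchings I J E"
  proof (rule num_matchings_reindex_le[OF _ _ bij_betw_inv_into[OF \<phi>] bij_betw_inv_into[OF \<psi>]])
    show "finite I'" "finite J'"
      using fin bij_betw_finite[OF \<phi>] bij_betw_finite[OF \<psi>] by auto
    show "inv_into J \<psi> j \<in> E (inv_into I \<phi> i)" if "i \<in> I'" "j \<in> J'" "j \<in> E' i" for i j
      using E[OF inv\<phi>(1) inv\<psi>(1)] inv\<phi>(2) inv\<psi>(2) that by auto
  qed
qed

lemma num_matchings_cong:
  assumes "\<And>i j. i \<in> I \<Longrightarrow> j \<in> J \<Longrightarrow> j \<in> E i \<longleftrightarrow> j \<in> E' i"
  shows "num_matchings I J E = num_matchings I J E'"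
proof -
  have "matchings I J E = matchings I J E'"
    unfolding matchings_def using assms by (auto simp: bij_betw_def)
  then show ?thesis by (simp add: num_matchings_def)
qed

text \<open>Inverting a matching gives one of the transposed matrix, injectively; transposing twice
  then yields equality.\<close>

lemma num_matchings_transpose_le:
  assumes "finite I" "finite J"
  shows "num_matchings I J E \<le> num_matchings J I (\<lambda>j. {i. j \<in> E i})"
  unfolding num_matchings_def
proof (rule card_inj_on_le)
  let ?T = "\<lambda>f. \<lambda>x\<in>J. inv_into I f x"
  show "inj_on ?T (matchings I J E)"
  proof (rule inj_onI)
    fix f g assume f: "f \<in> matchings I J E" and g: "g \<in> matchings I J E" and eq: "?T f = ?T g"
    show "f = g"
    proof (rule extensionalityI[OF matchingsD(1)[OF f] matchingsD(1)[OF g]])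
      fix i assume i: "i \<in> I"
      have J: "f i \<in> J"
        by (rule matchingsD(4)[OF f i])
      have "inv_into I f (f i) = inv_into I g (f i)"
        using fun_cong[OF eq, of "f i"] J by simp
      moreover have "inv_into I f (f i) = i"
        using matchingsD(2)[OF f] i by (auto simp: bij_betw_def inv_into_f_f)
      moreover have "g (inv_into I g (f i)) = f i"
        using matchingsD(2)[OF g] J by (auto simp: bij_betw_def f_inv_into_f)
      ultimately show "f i = g i" by simp
    qed
  qed
  show "?T ` matchings I J E \<subseteq> matchings J I (\<lambda>j. {i. j \<in> E i})"
  proof (intro image_subsetI matchingsI)
    fix f assume f: "f \<in> matchings I J E"
    show "bij_betw (?T f) J I"
      by (rule bij_betw_cong[THEN iffD1, OF _ bij_betw_inv_into[OF matchingsD(2)[OF f]]]) simp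
    fix x assume x: "x \<in> J"
    then have "inv_into I f x \<in> I" "f (inv_into I f x) = x"
      using matchingsD(2)[OF f] by (auto simp: bij_betw_def inv_into_into f_inv_into_f)
    then show "?T f x \<in> {i. x \<in> E i}"
      using matchingsD(3)[OF f, of "inv_into I f x"] x by simp
  qed simp
  show "finite (matchings J I (\<lambda>j. {i. j \<in> E i}))"
    using assms by (simp add: finite_matchings)
qed

lemma num_matchings_transpose:
  assumes "finite I" "finite J"
  shows "num_matchings I J E = num_matchings J I (\<lambda>j. {i. j \<in> E i})"
  using num_matchings_transpose_le[OF assms, of E]
    num_matchings_transpose_le[OF assms(2,1), of "\<lambda>j. {i. j \<in> E i}"] by simp

text \<open>Permanent of a block diagonal matrix. The supports send \<open>A\<close> into
  \<open>C\<close> and \<open>B\<close> into \<open>D\<close>, and surjectivity turns both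
  inclusions into equalities, so a matching splits into a pair.\<close>

lemma num_matchings_Un:
  assumes disj: "A \<inter> B = {}" "C \<inter> D = {}"
    and EA: "\<And>i. i \<in> A \<Longrightarrow> E i \<inter> D = {}" and EB: "\<And>i. i \<in> B \<Longrightarrow> E i \<inter> C = {}"
  shows "num_matchings (A \<union> B) (C \<union> D) E = num_matchings A C E * num_matchings B D E"
proof -
  let ?T = "\<lambda>f. (restrict f A, restrict f B)"
  let ?S = "\<lambda>(g, h) x. if x \<in> A then g x else h x"
  have "bij_betw ?T (matchings (A \<union> B) (C \<union> D) E) (matchings A C E \<times> matchings B D E)"
  proof (rule bij_betw_byWitness[where f' = ?S])
    show "\<forall>f\<in>matchings (A \<union> B) (C \<union> D) E. ?S (?T f) = f"
      by (auto simp: matchings_def extensional_def fun_eq_iff)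
    show "\<forall>p\<in>matchings A C E \<times> matchings B D E. ?T (?S p) = p"
      using disj by (auto simp: matchings_def extensional_def fun_eq_iff)
    show "?T ` matchings (A \<union> B) (C \<union> D) E \<subseteq> matchings A C E \<times> matchings B D E"
    proof (intro image_subsetI SigmaI matchingsI)
      fix f assume f: "f \<in> matchings (A \<union> B) (C \<union> D) E"
      have *: "f ` A \<union> f ` B = C \<union> D" "inj_on f (A \<union> B)"
        using matchingsD(2)[OF f] by (auto simp: bij_betw_def)
      have AC: "f ` A \<subseteq> C" and BD: "f ` B \<subseteq> D"
        using matchingsD(3,4)[OF f] EA EB by blast+
      have "C \<subseteq> f ` A"
        using equalityD2[OF *(1)] BD disj(2) by blast
      moreover have "D \<subseteq> f ` B"
        using equalityD2[OF *(1)] AC disj(2) by blast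
      ultimately have "f ` A = C" "f ` B = D"
        using AC BD by simp_all
      then have "bij_betw f A C" "bij_betw f B D"
        using *(2) by (auto simp: bij_betw_def inj_on_Un)
      then show "bij_betw (restrict f A) A C" "bij_betw (restrict f B) B D"
        by (auto simp: bij_betw_restrict_eq)
    qed (auto dest: matchingsD(3))
    show "?S ` (matchings A C E \<times> matchings B D E) \<subseteq> matchings (A \<union> B) (C \<union> D) E"
    proof (clarsimp, intro matchingsI)
      fix g h assume g: "g \<in> matchings A C E" and h: "h \<in> matchings B D E"
      have "bij_betw (\<lambda>x. if x \<in> A then g x else h x) A C"
        by (rule bij_betw_cong[THEN iffD1, OF _ matchingsD(2)[OF g]]) simp
      moreover have "bij_betw (\<lambda>x. if x \<in> A then g x else h x) B D"
        by (rule bij_betw_cong[THEN iffD1, OF _ matchingsD(2)[OF h]]) (use disj in auto)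
      ultimately show "bij_betw (\<lambda>x. if x \<in> A then g x else h x) (A \<union> B) (C \<union> D)"
        using disj(2) by (rule bij_betw_combine)
      show "(\<lambda>x. if x \<in> A then g x else h x) \<in> extensional (A \<union> B)"
        using matchingsD(1)[OF h] by (auto simp: extensional_def)
      show "(if i \<in> A then g i else h i) \<in> E i" if "i \<in> A \<union> B" for i
        using that matchingsD(3)[OF g, of i] matchingsD(3)[OF h, of i] by auto
    qed
  qed
  then show ?thesis
    unfolding num_matchings_def by (simp add: bij_betw_same_card card_cartesian_product)
qed

lemma card_matchings_through:
  assumes i: "i \<in> I" and k: "k \<in> E i \<inter> J"
  shows "card {f \<in> matchings I J E. f i = k} = num_matchings (I - {i}) (J - {k}) E"
proof -
  have "bij_betw (\<lambda>f. restrict f (I - {i})) {f \<in> matchings I J E. f i = k}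
      (matchings (I - {i}) (J - {k}) E)"
  proof (rule bij_betw_byWitness[where f' = "\<lambda>g. g(i := k)"])
    show "\<forall>f\<in>{f \<in> matchings I J E. f i = k}. (restrict f (I - {i}))(i := k) = f"
      by (auto simp: matchings_def extensional_def fun_eq_iff)
    show "\<forall>g\<in>matchings (I - {i}) (J - {k}) E. restrict (g(i := k)) (I - {i}) = g"
      by (auto simp: matchings_def extensional_def fun_eq_iff)
    show "(\<lambda>f. restrict f (I - {i})) ` {f \<in> matchings I J E. f i = k}
        \<subseteq> matchings (I - {i}) (J - {k}) E"
    proof (clarify, intro matchingsI)
      fix f assume f: "f \<in> matchings I J E" and "k = f i"
      then have "bij_betw f (I - {i}) (J - {f i})"
        using i matchingsD(4)[OF f i] by (intro bij_betw_DiffI matchingsD(2)[OF f]) auto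
      then show "bij_betw (restrict f (I - {i})) (I - {i}) (J - {f i})"
        by (simp only: bij_betw_restrict_eq)
    qed (auto dest: matchingsD(3))
    show "(\<lambda>g. g(i := k)) ` matchings (I - {i}) (J - {k}) E \<subseteq> {f \<in> matchings I J E. f i = k}"
    proof (clarsimp, intro matchingsI)
      fix g assume g: "g \<in> matchings (I - {i}) (J - {k}) E"
      have "bij_betw (g(i := k)) (I - {i}) (J - {k})"
        by (rule bij_betw_cong[THEN iffD1, OF _ matchingsD(2)[OF g]]) simp
      moreover have "bij_betw (g(i := k)) {i} {k}"
        by (simp add: bij_betw_def)
      ultimately have "bij_betw (g(i := k)) ((I - {i}) \<union> {i}) ((J - {k}) \<union> {k})"
        by (rule bij_betw_combine) auto
      moreover have "(I - {i}) \<union> {i} = I" "(J - {k}) \<union> {k} = J"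
        using i k by auto
      ultimately show "bij_betw (g(i := k)) I J" by simp
      show "g(i := k) \<in> extensional I"
        using matchingsD(1)[OF g] i by (auto simp: extensional_def)
      show "(g(i := k)) x \<in> E x" if "x \<in> I" for x
        using that matchingsD(3)[OF g, of x] k by auto
    qed
  qed
  then show ?thesis
    unfolding num_matchings_def by (rule bij_betw_same_card)
qed

text \<open>Groups the matchings by their value at \<open>i\<close>. Taking \<open>h = 1\<close>
  gives the Laplace expansion; taking \<open>h\<close> to be the logarithm of the minor gives the
  entropy terms in Bregman's theorem.\<close>

lemma sum_over_matchings:
  fixes h :: "'b \<Rightarrow> real"
  assumes fin: "finite I" "finite J" and i: "i \<in> I"
  shows "(\<Sum>f\<in>matchings I J E. h (f i)) =
    (\<Sum>k\<in>E i \<inter> J. real (num_matchings (I - {i}) (J - {k}) E) * h k)"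
proof -
  have "(\<Sum>f\<in>matchings I J E. h (f i)) =
      (\<Sum>k\<in>E i \<inter> J. \<Sum>f\<in>{f \<in> matchings I J E. f i = k}. h (f i))"
    using fin i finite_matchings[OF fin] by (intro sum.group[symmetric]) (auto dest: matchingsD)
  also have "\<dots> = (\<Sum>k\<in>E i \<inter> J. real (num_matchings (I - {i}) (J - {k}) E) * h k)"
    by (intro sum.cong refl) (simp add: card_matchings_through[OF i, symmetric])
  finally show ?thesis .
qed

lemma num_matchings_expand:
  assumes "finite I" "finite J" "i \<in> I"
  shows "num_matchings I J E = (\<Sum>k\<in>E i \<inter> J. num_matchings (I - {i}) (J - {k}) E)"
proof -
  have "real (num_matchings I J E) = real (\<Sum>k\<in>E i \<inter> J. num_matchings (I - {i}) (J - {k}) E)"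
    using sum_over_matchings[OF assms, of "\<lambda>_. 1" E] by (simp add: num_matchings_def)
  then show ?thesis by (simp only: of_nat_eq_iff)
qed

lemma num_matchings_complete:
  assumes "finite I" "finite J" "card I = card J" "\<And>i. i \<in> I \<Longrightarrow> J \<subseteq> E i"
  shows "num_matchings I J E = fact (card I)"
  using assms
proof (induction I arbitrary: J rule: finite_induct)
  case empty
  then have "matchings {} J E = {\<lambda>x. undefined}"
    by (auto simp: matchings_def bij_betw_def)
  then show ?case by (simp add: num_matchings_def)
next
  case (insert i I)
  have "num_matchings (insert i I) J E = (\<Sum>k\<in>E i \<inter> J. num_matchings I (J - {k}) E)"
    using insert.hyps insert.prems by (subst num_matchings_expand[where i = i]) auto
  also have "\<dots> = (\<Sum>k\<in>J. fact (card I))"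
    using insert.prems insert.hyps by (intro sum.cong insert.IH) auto
  also have "\<dots> = fact (card (insert i I))"
    using insert.hyps by (simp flip: insert.prems(2))
  finally show ?case .
qed

lemma permanent_eq_num_matchings:
  "permanent (mat N N (\<lambda>(i, j). if j \<in> E i then 1 else 0)) = num_matchings {0..<N} {0..<N} E"
proof -
  let ?S = "{0..<N}"
  let ?P = "{p. p permutes ?S \<and> (\<forall>i\<in>?S. p i \<in> E i)}"
  define M where "M = mat N N (\<lambda>(i, j). if j \<in> E i then 1 else (0::nat))"
  have "permanent M = (\<Sum>p | p permutes ?S. \<Prod>i\<in>?S. M $$ (i, p i))"
    by (simp add: permanent_def M_def)
  also have "\<dots> = (\<Sum>p | p permutes ?S. if \<forall>i\<in>?S. p i \<in> E i then 1 else 0)"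
  proof (intro sum.cong refl)
    fix p assume "p \<in> {p. p permutes ?S}"
    then have "p i < N" if "i < N" for i
      using that permutes_in_image[of p ?S i] by auto
    then have "(\<Prod>i\<in>?S. M $$ (i, p i)) = (\<Prod>i\<in>?S. if p i \<in> E i then 1 else 0)"
      by (intro prod.cong) (auto simp: M_def)
    also have "\<dots> = (if \<forall>i\<in>?S. p i \<in> E i then 1 else 0)"
      by auto
    finally show "(\<Prod>i\<in>?S. M $$ (i, p i)) = (if \<forall>i\<in>?S. p i \<in> E i then 1 else 0)" .
  qed
  also have "\<dots> = card {p \<in> {p. p permutes ?S}. \<forall>i\<in>?S. p i \<in> E i}"
    by (subst sum.inter_filter[symmetric]) (simp_all add: finite_permutations)
  finally have *: "permanent M = card ?P" by simp
  have "bij_betw (\<lambda>p. restrict p ?S) ?P (matchings ?S ?S E)"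
  \<comment> \<open>Outside \<open>{0..<N}\<close> a permutation is the identity and a matching is
    \<open>undefined\<close>; the two maps exchange these default values.\<close>
  proof (rule bij_betw_byWitness[where f' = "\<lambda>f x. if x \<in> ?S then f x else x"])
    show "\<forall>p\<in>?P. (\<lambda>x. if x \<in> ?S then restrict p ?S x else x) = p"
      by (auto simp: fun_eq_iff permutes_def)
    show "\<forall>f\<in>matchings ?S ?S E. restrict (\<lambda>x. if x \<in> ?S then f x else x) ?S = f"
      by (auto simp: fun_eq_iff matchings_def extensional_def)
    show "(\<lambda>p. restrict p ?S) ` ?P \<subseteq> matchings ?S ?S E"
    proof (clarify, intro matchingsI)
      fix p assume "p permutes ?S"
      then show "bij_betw (restrict p ?S) ?S ?S"
        by (intro bij_betw_cong[THEN iffD1, OF _ permutes_imp_bij[of p]]) auto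
    qed auto
    show "(\<lambda>f x. if x \<in> ?S then f x else x) ` matchings ?S ?S E \<subseteq> ?P"
    proof (clarify, intro conjI ballI bij_imp_permutes)
      fix f assume f: "f \<in> matchings ?S ?S E"
      show "bij_betw (\<lambda>x. if x \<in> ?S then f x else x) ?S ?S"
        by (intro bij_betw_cong[THEN iffD1, OF _ matchingsD(2)[OF f]]) auto
    qed (auto dest: matchingsD(3))
  qed
  then have "card ?P = num_matchings ?S ?S E"
    unfolding num_matchings_def by (rule bij_betw_same_card)
  with * show ?thesis by (simp add: M_def)
qed

section \<open>Bregman's theorem and its equality case\<close>

text \<open>Logarithm of the Bregman factor of a row with sum \<open>r\<close>. Division by zero
  makes it 0 at \<open>r = 0\<close>.\<close>

definition log_gfact :: "nat \<Rightarrow> real" where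
  "log_gfact r = ln (fact r) / r"

lemma mult_log_gfact: "real r * log_gfact r = ln (fact r)"
  by (cases "r = 0") (simp_all add: log_gfact_def)

text \<open>The value \<open>ln 0 = 0\<close> gives the convention \<open>0 ln 0 = 0\<close> of entropy.\<close>

definition entropy_gap :: "('b \<Rightarrow> real) \<Rightarrow> 'b set \<Rightarrow> real" where
  "entropy_gap p S = (\<Sum>k\<in>S. p k * ln (p k)) - sum p S * ln (sum p S / card S)"

text \<open>The left side is the tangent at \<open>a\<close> of the strictly convex function
  \<open>p * ln p\<close>. It comes from \<open>ln x \<le> x - 1\<close> at
  \<open>x = a / p\<close>, with \<open>p = 0\<close> treated separately.\<close>

lemma mult_ln_ge:
  assumes "0 \<le> p" "0 < (a::real)"
  shows "p * ln a + p - a \<le> p * ln p" and "p \<noteq> a \<Longrightarrow> p * ln a + p - a < p * ln p"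
proof -
  have *: "p * ln (a / p) \<le> p * (a / p - 1)" "p \<noteq> a \<Longrightarrow> p * ln (a / p) < p * (a / p - 1)" if "p > 0"
  proof -
    have "0 < a / p" using that assms by simp
    then have "ln (a / p) \<le> a / p - 1" "ln (a / p) = a / p - 1 \<Longrightarrow> a / p = 1"
      using ln_le_minus_one ln_eq_minus_one by blast+
    then show "p * ln (a / p) \<le> p * (a / p - 1)" "p \<noteq> a \<Longrightarrow> p * ln (a / p) < p * (a / p - 1)"
      using that by (auto simp: less_le)
  qed
  show "p * ln a + p - a \<le> p * ln p"
    using *(1) assms by (cases "p = 0") (auto simp: ln_div algebra_simps)
  show "p * ln a + p - a < p * ln p" if "p \<noteq> a"
    using *(2) assms that by (cases "p = 0") (auto simp: ln_div algebra_simps)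
qed

text \<open>Sum the tangent inequality at the mean \<open>a\<close> of \<open>p\<close>: the terms
  \<open>p k - a\<close> cancel, so the gap is a sum of nonnegative tangent errors, and it vanishes
  only if every \<open>p k\<close> equals the mean.\<close>

lemma
  assumes S: "finite S" "\<And>k. k \<in> S \<Longrightarrow> 0 \<le> p k" "0 < sum p S"
  shows entropy_gap_nonneg: "0 \<le> entropy_gap p S"
    and entropy_gap_eq_0D: "entropy_gap p S = 0 \<Longrightarrow> k \<in> S \<Longrightarrow> p k = sum p S / card S"
proof -
  define a where "a = sum p S / card S"
  have "S \<noteq> {}" using S(3) by auto
  then have card: "0 < real (card S)" using S(1) by (simp add: card_gt_0_iff)
  then have a: "0 < a" using S(3) by (simp add: a_def)
  have "sum p S * ln a = (\<Sum>k\<in>S. p k * ln a + p k - a)"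
    using card by (simp add: sum.distrib sum_subtractf a_def sum_distrib_right)
  then have gap: "entropy_gap p S = (\<Sum>k\<in>S. p k * ln (p k) - (p k * ln a + p k - a))"
    by (simp add: entropy_gap_def a_def[symmetric] sum_subtractf)
  have nonneg: "0 \<le> p k * ln (p k) - (p k * ln a + p k - a)" if "k \<in> S" for k
    using mult_ln_ge(1)[OF S(2)[OF that] a] by simp
  show "0 \<le> entropy_gap p S"
    unfolding gap by (intro sum_nonneg nonneg)
  show "p k = sum p S / card S" if "entropy_gap p S = 0" "k \<in> S"
  proof (rule ccontr)
    assume "p k \<noteq> sum p S / card S"
    then have "0 < p k * ln (p k) - (p k * ln a + p k - a)"
      using mult_ln_ge(2)[OF S(2)[OF that(2)] a] by (simp add: a_def)
    moreover have "p k * ln (p k) - (p k * ln a + p k - a) = 0"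
      using that nonneg S(1) unfolding gap by (subst (asm) sum_nonneg_eq_0_iff) auto
    ultimately show False by simp
  qed
qed

text \<open>Logarithm of Bregman's bound minus logarithm of the permanent, so that nonnegativity is
  Bregman's theorem. Without any matching the value is meaningless because \<open>ln 0 = 0\<close>;
  hence the positivity hypotheses below.\<close>

definition bregman_gap :: "'a set \<Rightarrow> 'b set \<Rightarrow> ('a \<Rightarrow> 'b set) \<Rightarrow> real" where
  "bregman_gap I J E = (\<Sum>i\<in>I. log_gfact (card (E i \<inter> J))) - ln (num_matchings I J E)"

text \<open>Fix a row \<open>j\<close> with sum \<open>r\<close>. Deleting row \<open>i\<close> and
  column \<open>f i\<close> lowers this sum to \<open>r - 1\<close> for \<open>r - 1\<close> choices
  of \<open>i\<close> and leaves it unchanged for \<open>card I - r\<close> choices. As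
  \<open>r * log_gfact r = ln (r!)\<close>, the total is \<open>card I * log_gfact r - ln r\<close>,
  which does not depend on \<open>f\<close>.\<close>

lemma sum_log_gfact_minors:
  assumes fin: "finite I" "finite J" and f: "f \<in> matchings I J E"
  shows "(\<Sum>i\<in>I. \<Sum>j\<in>I - {i}. log_gfact (card (E j \<inter> (J - {f i})))) =
    (\<Sum>j\<in>I. real (card I) * log_gfact (card (E j \<inter> J)) - ln (card (E j \<inter> J)))"
proof -
  have bij: "bij_betw f I J" by (rule matchingsD(2)[OF f])
  have row: "(\<Sum>i\<in>I - {j}. log_gfact (card (E j \<inter> (J - {f i})))) =
      real (card I) * log_gfact (card (E j \<inter> J)) - ln (card (E j \<inter> J))" if j: "j \<in> I" for j
  proof -
    let ?R = "E j \<inter> J"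
    have fj: "f j \<in> ?R" using matchingsD(3,4)[OF f j] by simp
    then have pos: "0 < card ?R" using fin by (auto simp: card_gt_0_iff)
    have "bij_betw f (I - {j}) (J - {f j})"
      using j fj by (intro bij_betw_DiffI bij) auto
    then have "(\<Sum>i\<in>I - {j}. log_gfact (card (E j \<inter> (J - {f i})))) =
        (\<Sum>k\<in>J - {f j}. log_gfact (card (E j \<inter> (J - {k}))))"
      by (rule sum.reindex_bij_betw)
    also have "\<dots> = (\<Sum>k\<in>J - ?R. log_gfact (card ?R)) + (\<Sum>k\<in>?R - {f j}. log_gfact (card ?R - 1))"
    proof -
      have "J - {f j} = (J - ?R) \<union> (?R - {f j})" using fj by auto
      then have "(\<Sum>k\<in>J - {f j}. log_gfact (card (E j \<inter> (J - {k})))) =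
          (\<Sum>k\<in>J - ?R. log_gfact (card (E j \<inter> (J - {k})))) +
          (\<Sum>k\<in>?R - {f j}. log_gfact (card (E j \<inter> (J - {k}))))"
        using fin by (simp only:) (intro sum.union_disjoint, auto)
      also have "(\<Sum>k\<in>J - ?R. log_gfact (card (E j \<inter> (J - {k})))) = (\<Sum>k\<in>J - ?R. log_gfact (card ?R))"
        by (intro sum.cong refl arg_cong[where f = "\<lambda>S. log_gfact (card S)"]) auto
      also have "(\<Sum>k\<in>?R - {f j}. log_gfact (card (E j \<inter> (J - {k})))) = (\<Sum>k\<in>?R - {f j}. log_gfact (card ?R - 1))"
      proof (intro sum.cong refl)
        fix k assume "k \<in> ?R - {f j}"
        moreover have "E j \<inter> (J - {k}) = ?R - {k}" by auto
        ultimately show "log_gfact (card (E j \<inter> (J - {k}))) = log_gfact (card ?R - 1)"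
          using fin by simp
      qed
      finally show ?thesis .
    qed
    also have "\<dots> = real (card J - card ?R) * log_gfact (card ?R) + real (card ?R - 1) * log_gfact (card ?R - 1)"
      using fin fj by (simp add: card_Diff_subset_Int Int_commute Int_left_commute)
    also have "real (card ?R - 1) * log_gfact (card ?R - 1) = ln (fact (card ?R)) - ln (card ?R)"
    proof -
      have "(fact (card ?R) :: real) = real (card ?R) * fact (card ?R - 1)"
        by (simp add: fact_reduce[OF pos])
      then show ?thesis using pos by (simp only: mult_log_gfact) (simp add: ln_mult)
    qed
    also have "real (card J - card ?R) = real (card I) - card ?R"
      using bij_betw_same_card[OF bij] card_mono[OF fin(2), of ?R] by simp
    also have "(real (card I) - card ?R) * log_gfact (card ?R) + (ln (fact (card ?R)) - ln (card ?R)) =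
        real (card I) * log_gfact (card ?R) - ln (card ?R)"
      by (simp add: algebra_simps mult_log_gfact)
    finally show ?thesis .
  qed
  have "(\<Sum>i\<in>I. \<Sum>j\<in>I - {i}. log_gfact (card (E j \<inter> (J - {f i})))) =
      (\<Sum>j\<in>I. \<Sum>i\<in>I - {j}. log_gfact (card (E j \<inter> (J - {f i}))))"
    using sum.swap_restrict[OF fin(1) fin(1), of "\<lambda>i j. log_gfact (card (E j \<inter> (J - {f i})))" "\<lambda>i j. i \<noteq> j"]
    by (simp add: set_diff_eq conj_commute eq_commute)
  then show ?thesis by (simp add: row)
qed

text \<open>Schrijver's proof of Bregman's theorem, written as an identity between nonnegative
  defects so that the equality case can be read off as well.\<close>

lemma bregman_gap_identity:
  assumes fin: "finite I" "finite J" and pos: "0 < num_matchings I J E"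
  shows "card I * num_matchings I J E * bregman_gap I J E =
    (\<Sum>i\<in>I. entropy_gap (\<lambda>k. num_matchings (I - {i}) (J - {k}) E) (E i \<inter> J)) +
    (\<Sum>f\<in>matchings I J E. \<Sum>i\<in>I. bregman_gap (I - {i}) (J - {f i}) E)"
proof -
  let ?M = "matchings I J E"
  define P where "P = real (num_matchings I J E)"
  define L where "L = (\<Sum>f\<in>?M. \<Sum>i\<in>I. ln (num_matchings (I - {i}) (J - {f i}) E))"
  define G where "G = (\<Sum>j\<in>I. log_gfact (card (E j \<inter> J)))"
  define H where "H = (\<Sum>j\<in>I. ln (card (E j \<inter> J)))"
  have P: "0 < P" "real (card ?M) = P" using pos by (simp_all add: P_def num_matchings_def)
  have card_pos: "0 < card (E i \<inter> J)" if "i \<in> I" for i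
  proof -
    obtain f where "f \<in> ?M" using pos fin num_matchings_pos_iff by blast
    then show ?thesis using matchingsD(3,4)[of f I J E i] fin that by (auto simp: card_gt_0_iff)
  qed
  have "entropy_gap (\<lambda>k. num_matchings (I - {i}) (J - {k}) E) (E i \<inter> J) =
      (\<Sum>f\<in>?M. ln (num_matchings (I - {i}) (J - {f i}) E)) - P * ln P + P * ln (card (E i \<inter> J))"
    if i: "i \<in> I" for i
  proof -
    \<comment> \<open>Expansion along row \<open>i\<close>: the minors add up to the permanent, so
      \<open>P\<close> is the total mass in each entropy gap.\<close>
    have "(\<Sum>k\<in>E i \<inter> J. real (num_matchings (I - {i}) (J - {k}) E)) = P"
      unfolding P_def num_matchings_expand[OF fin i] by simp
    then show ?thesis
      using P(1) card_pos[OF i]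
      by (simp add: entropy_gap_def sum_over_matchings[OF fin i, of "\<lambda>k. ln (num_matchings (I - {i}) (J - {k}) E)"]
          ln_div algebra_simps)
  qed
  then have "(\<Sum>i\<in>I. entropy_gap (\<lambda>k. num_matchings (I - {i}) (J - {k}) E) (E i \<inter> J)) =
      (\<Sum>i\<in>I. \<Sum>f\<in>?M. ln (num_matchings (I - {i}) (J - {f i}) E)) - card I * (P * ln P) + P * H"
    by (simp add: sum.distrib sum_subtractf H_def sum_distrib_left)
  also have "(\<Sum>i\<in>I. \<Sum>f\<in>?M. ln (num_matchings (I - {i}) (J - {f i}) E)) = L"
    unfolding L_def by (rule sum.swap)
  finally have 1: "(\<Sum>i\<in>I. entropy_gap (\<lambda>k. num_matchings (I - {i}) (J - {k}) E) (E i \<inter> J)) =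
      L - card I * (P * ln P) + P * H" .
  have "(\<Sum>f\<in>?M. \<Sum>i\<in>I. bregman_gap (I - {i}) (J - {f i}) E) = (\<Sum>f\<in>?M. card I * G - H) - L"
    by (simp add: bregman_gap_def sum_subtractf sum_log_gfact_minors[OF fin] L_def G_def H_def sum_distrib_left)
  then have 2: "(\<Sum>f\<in>?M. \<Sum>i\<in>I. bregman_gap (I - {i}) (J - {f i}) E) = P * (card I * G - H) - L"
    by (simp add: P(2))
  \<comment> \<open>The terms \<open>L\<close> and \<open>P * H\<close> occur with opposite signs in
    the two sums and cancel, leaving \<open>card I * P * (G - ln P)\<close>.\<close>
  show ?thesis
    unfolding 1 2 by (simp add: bregman_gap_def G_def[symmetric] P_def[symmetric] algebra_simps)
qed

lemma num_matchings_minor_pos: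
  assumes "finite I" "finite J" "f \<in> matchings I J E" "i \<in> I"
  shows "0 < num_matchings (I - {i}) (J - {f i}) E"
proof -
  have "f \<in> {g \<in> matchings I J E. g i = f i}" using assms(3) by simp
  moreover have "finite {g \<in> matchings I J E. g i = f i}"
    using finite_matchings[OF assms(1,2)] by simp
  ultimately have "0 < card {g \<in> matchings I J E. g i = f i}"
    by (auto simp: card_gt_0_iff)
  then show ?thesis
    using card_matchings_through[OF assms(4), of "f i" E J] matchingsD(3,4)[OF assms(3,4)] by simp
qed

lemma sum_minors_pos:
  assumes "finite I" "finite J" "0 < num_matchings I J E" "i \<in> I"
  shows "0 < (\<Sum>k\<in>E i \<inter> J. real (num_matchings (I - {i}) (J - {k}) E))"
  using assms(3) unfolding num_matchings_expand[OF assms(1,2,4)] of_nat_sum[symmetric] of_nat_0_less_iff .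

text \<open>Bregman's theorem by induction on the number of rows: the right side of the identity is
  a sum of entropy gaps and of gaps of smaller matrices with a matching.\<close>

lemma bregman_gap_nonneg:
  assumes "finite I" "finite J" "0 < num_matchings I J E"
  shows "0 \<le> bregman_gap I J E"
  using assms
proof (induction "card I" arbitrary: I J)
  case 0
  then have "I = {}" "J = {}"
    using num_matchings_pos_iff[OF 0(2,3)] by (auto simp: matchings_def bij_betw_def)
  then show ?case
    by (simp add: bregman_gap_def num_matchings_complete)
next
  case (Suc m)
  have "0 \<le> (\<Sum>i\<in>I. entropy_gap (\<lambda>k. num_matchings (I - {i}) (J - {k}) E) (E i \<inter> J))"
    using Suc.prems by (intro sum_nonneg entropy_gap_nonneg sum_minors_pos) auto
  moreover have "0 \<le> (\<Sum>f\<in>matchings I J E. \<Sum>i\<in>I. bregman_gap (I - {i}) (J - {f i}) E)"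
    using Suc by (intro sum_nonneg Suc.hyps(1) num_matchings_minor_pos) auto
  ultimately have "0 \<le> card I * num_matchings I J E * bregman_gap I J E"
    unfolding bregman_gap_identity[OF Suc.prems] by simp
  moreover have "0 < real (card I * num_matchings I J E)"
    using Suc.hyps(2)[symmetric] Suc.prems(3) by (simp only: of_nat_0_less_iff) simp
  ultimately show ?case
    by (metis linorder_not_le mult_pos_neg)
qed

text \<open>Equality makes every term of the identity vanish. Zero entropy gap means that all minors
  along a row have the same permanent, hence a positive one.\<close>

lemma bregman_equality_minors:
  assumes fin: "finite I" "finite J" and pos: "0 < num_matchings I J E" and eq: "bregman_gap I J E = 0"
    and i: "i \<in> I" and k: "k \<in> E i \<inter> J"
  shows "0 < num_matchings (I - {i}) (J - {k}) E" and "bregman_gap (I - {i}) (J - {k}) E = 0"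
proof -
  let ?p = "\<lambda>i k. real (num_matchings (I - {i}) (J - {k}) E)"
  let ?a = "\<lambda>i. entropy_gap (?p i) (E i \<inter> J)"
  let ?b = "\<lambda>f. \<Sum>i\<in>I. bregman_gap (I - {i}) (J - {f i}) E"
  have a: "0 \<le> ?a i" if "i \<in> I" for i
    using fin pos that by (intro entropy_gap_nonneg sum_minors_pos) auto
  have b: "0 \<le> bregman_gap (I - {i}) (J - {f i}) E" if "f \<in> matchings I J E" "i \<in> I" for f i
    using fin that by (intro bregman_gap_nonneg num_matchings_minor_pos) auto
  have "(\<Sum>i\<in>I. ?a i) + (\<Sum>f\<in>matchings I J E. ?b f) = 0"
    using bregman_gap_identity[OF fin pos] eq by simp
  moreover have "0 \<le> (\<Sum>i\<in>I. ?a i)" "0 \<le> (\<Sum>f\<in>matchings I J E. ?b f)"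
    by (intro sum_nonneg a b; simp)+
  ultimately have sums: "(\<Sum>i\<in>I. ?a i) = 0" "(\<Sum>f\<in>matchings I J E. ?b f) = 0"
    by linarith+
  have "?a i = 0"
    using sums(1) sum_nonneg_eq_0_iff[OF fin(1), of ?a] a i by auto
  then have "?p i k = (\<Sum>k\<in>E i \<inter> J. ?p i k) / card (E i \<inter> J)"
    using fin pos i k by (intro entropy_gap_eq_0D sum_minors_pos) auto
  moreover have "0 < card (E i \<inter> J)"
    using k fin by (auto simp: card_gt_0_iff)
  ultimately have "0 < ?p i k"
    using sum_minors_pos[OF fin pos i] by simp
  then show minor: "0 < num_matchings (I - {i}) (J - {k}) E" by simp
  \<comment> \<open>The identity only controls minors met by a matching, so a matching through the
    entry \<open>(i, k)\<close> is needed; positivity of the minor provides it.\<close>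
  then have "{f \<in> matchings I J E. f i = k} \<noteq> {}"
    using card_matchings_through[OF i, of k E J] k by force
  then obtain f where f: "f \<in> matchings I J E" "f i = k" by blast
  have "?b f = 0"
    using sums(2) sum_nonneg_eq_0_iff[OF finite_matchings[OF fin], of E ?b] b f(1)
    by (auto intro!: sum_nonneg)
  then show "bregman_gap (I - {i}) (J - {k}) E = 0"
    using sum_nonneg_eq_0_iff[OF fin(1), of "\<lambda>i. bregman_gap (I - {i}) (J - {f i}) E"] b[OF f(1)] i f(2)
    by auto
qed

lemma num_matchings_row_nonempty:
  assumes "finite I" "finite J" "0 < num_matchings I J E" "i \<in> I"
  shows "E i \<inter> J \<noteq> {}"
  using sum_minors_pos[OF assms] by auto

text \<open>Equality passes to every minor, so two rows that overlap in \<open>c\<close> and differ in \<open>d\<close> confine all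
  other rows to \<open>{c, d}\<close>; deleting \<open>c\<close> or \<open>d\<close> then gives a contradiction.\<close>

lemma bregman_equality_rows:
  assumes "finite I" "finite J" "0 < num_matchings I J E" "bregman_gap I J E = 0"
    and "i \<in> I" "j \<in> I" "E i \<inter> E j \<inter> J \<noteq> {}"
  shows "E i \<inter> J = E j \<inter> J"
proof -
  \<comment> \<open>One inclusion is proved for all pairs \<open>i\<close>, \<open>j\<close>,
    because the induction hypothesis is also used with the two rows interchanged.\<close>
  have "E i \<inter> J \<subseteq> E j \<inter> J"
    if "finite I" "finite J" "0 < num_matchings I J E" "bregman_gap I J E = 0"
      "i \<in> I" "j \<in> I" "E i \<inter> E j \<inter> J \<noteq> {}" for i j
    using that
  proof (induction "card I" arbitrary: I J i j)
    case 0
    then show ?case by simp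
  next
    case (Suc m)
    note fin = Suc.prems(1,2) and minor = bregman_equality_minors[OF Suc.prems(1-4)]
      and i = Suc.prems(5) and j = Suc.prems(6)
    have IH: "E u \<inter> (J - {k}) \<subseteq> E v \<inter> (J - {k})"
      if "l \<in> I" "k \<in> E l \<inter> J" "u \<in> I - {l}" "v \<in> I - {l}" "E u \<inter> E v \<inter> (J - {k}) \<noteq> {}" for l k u v
    proof (rule Suc.hyps(1)[OF _ _ _ minor[OF that(1,2)] that(3,4,5)])
      show "m = card (I - {l})" using Suc.hyps(2) that(1) fin by simp
    qed (use fin in auto)
    show ?case
    proof (rule ccontr)
      assume "\<not> E i \<inter> J \<subseteq> E j \<inter> J"
      then obtain d where d: "d \<in> J" "d \<in> E i" "d \<notin> E j" by auto
      obtain c where c: "c \<in> J" "c \<in> E i" "c \<in> E j" using Suc.prems(7) by auto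
      have "i \<noteq> j" using d by auto
      \<comment> \<open>Deleting row \<open>i\<close> and column \<open>c\<close> leaves a positive
        minor, so row \<open>j\<close> has an entry besides \<open>c\<close>.\<close>
      have "E j \<inter> (J - {c}) \<noteq> {}"
        using fin i j c \<open>i \<noteq> j\<close>
        by (intro num_matchings_row_nonempty[of "I - {i}"] minor(1)) auto
      then obtain e where e: "e \<in> J" "e \<in> E j" "e \<noteq> c" by auto
      have "e \<noteq> d" using d e by auto
      show False
      proof (cases "I = {i, j}")
        case True
        obtain f where "f \<in> matchings I J E"
          using num_matchings_pos_iff[OF fin] Suc.prems(3) by blast
        then have "card I = card J"
          by (intro bij_betw_same_card matchingsD(2))
        then have "card J = 2"
          using True \<open>i \<noteq> j\<close> by simp
        moreover have "card {c, d, e} \<le> card J"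
          using c d e fin by (intro card_mono) auto
        moreover have "card {c, d, e} = 3"
          using c(3) d(3) e(3) \<open>e \<noteq> d\<close> by (subst card_3_iff) blast
        ultimately show False by simp
      next
        case False
        then obtain l where l: "l \<in> I" "l \<noteq> i" "l \<noteq> j" using i j by auto
        \<comment> \<open>If row \<open>l\<close> had another entry \<open>k\<close>, deleting
          \<open>l\<close> and \<open>k\<close> would keep the overlap \<open>c\<close> and the
          difference \<open>d\<close>, against the induction hypothesis.\<close>
        have sub: "E l \<inter> J \<subseteq> {c, d}"
        proof
          fix k assume "k \<in> E l \<inter> J"
          then show "k \<in> {c, d}"
            using IH[of l k i j] l i j c d by auto
        qed
        have "E l \<inter> (J - {x}) \<noteq> {}" if "x \<in> E i \<inter> J" for x
          using fin i l that by (intro num_matchings_row_nonempty[of "I - {i}"] minor(1)) auto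
        from this[of c] this[of d] have l_cd: "c \<in> E l" "d \<in> E l"
          using sub c d by auto
        \<comment> \<open>Deleting \<open>l\<close> and \<open>d\<close> keeps the overlap
          \<open>c\<close>, so \<open>e\<close> passes from row \<open>j\<close> to row
          \<open>i\<close>. Deleting \<open>l\<close> and \<open>c\<close> afterwards keeps the
          overlap \<open>e\<close>, which forces \<open>d\<close> into row \<open>j\<close>.\<close>
        have "e \<in> E i"
          using IH[of l d j i] l l_cd i j c d e \<open>e \<noteq> d\<close> by auto
        then show False
          using IH[of l c i j] l l_cd i j c d e by auto
      qed
    qed
  qed
  from this[OF assms(1-6)] this[OF assms(1-4) assms(6,5)] show ?thesis
    using assms(7) by blast
qed

section \<open>A matrix and its complement\<close>

lemma log_gfact_increment:
  assumes "r \<ge> 1"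
  shows "log_gfact (Suc r) - log_gfact r = (r * ln (Suc r) - ln (fact r)) / (r * Suc r)"
proof -
  have "(L + F) / (a + 1) - F / a = (a * L - F) / (a * (a + 1))" if "a > 0" for a L F :: real
    using that by (simp add: field_simps)
  from this[of "real r" "ln (real r + 1)" "ln (fact r)"] show ?thesis
    using assms by (simp add: log_gfact_def ln_mult add.commute del: mult_Suc_right)
qed

lemma ln_Suc_diff_bounds:
  assumes "r > 0"
  shows "1 / real (Suc r) \<le> ln (Suc r) - ln r" and "ln (Suc r) - ln r < 1 / real r"
proof -
  have "ln (real r / real (Suc r)) \<le> real r / real (Suc r) - 1"
    using assms by (intro ln_le_minus_one) simp
  moreover have "real r / real (Suc r) - 1 = - (1 / real (Suc r))"
    by (simp add: field_simps)
  ultimately show "1 / real (Suc r) \<le> ln (Suc r) - ln r"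
    using assms by (simp add: ln_div del: of_nat_Suc)
  define q where "q = real (Suc r) / real r"
  have q: "0 < q" "q \<noteq> 1" "q - 1 = 1 / real r" "ln q = ln (Suc r) - ln r"
    using assms by (simp_all add: q_def ln_div field_simps del: of_nat_Suc)
  have "ln q \<noteq> q - 1"
    using ln_eq_minus_one[OF q(1)] q(2) by blast
  then show "ln (Suc r) - ln r < 1 / real r"
    using ln_le_minus_one[OF q(1)] q(3,4) by linarith
qed

text \<open>The right side grows by \<open>(r + 1) * (ln (r + 2) - ln (r + 1))\<close> from
  \<open>r\<close> to \<open>r + 1\<close>, which is at least
  \<open>(r + 1) / (r + 2) \<ge> 1/2\<close>.\<close>

lemma half_le_ln_fact_gap: "real r / 2 \<le> r * ln (Suc r) - ln (fact r)"
proof (induction r)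
  case (Suc r)
  have "1 / 2 \<le> real (Suc r) * (1 / real (Suc (Suc r)))"
    by (simp add: field_simps)
  also have "\<dots> \<le> Suc r * (ln (Suc (Suc r)) - ln (Suc r))"
    by (intro mult_left_mono ln_Suc_diff_bounds) simp_all
  finally have "1 / 2 \<le> Suc r * ln (Suc (Suc r)) - Suc r * ln (Suc r)"
    by (simp only: right_diff_distrib)
  moreover have "ln (fact (Suc r) :: real) = ln (Suc r) + ln (fact r)"
    by (simp add: ln_mult)
  moreover have "real (Suc r) * ln (Suc r) = real r * ln (Suc r) + ln (Suc r)"
    by (simp add: algebra_simps)
  moreover have "real (Suc r) / 2 = real r / 2 + 1 / 2" by (simp add: field_simps)
  ultimately show ?case
    using Suc.IH by linarith
qed simp

text \<open>The increment at \<open>r\<close> is \<open>h / (r * (r + 1))\<close>. After clearing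
  denominators the claim reads \<open>r * (r + 1) * x < 2 * h\<close>; here
  \<open>x < 1 / (r + 1)\<close> bounds the left side by \<open>r\<close>, and
  \<open>r \<le> 2 * h\<close> is the previous lemma. At \<open>r = 0\<close> the claim fails: the
  increments are 0 and \<open>ln 2 / 2\<close>.\<close>

lemma log_gfact_increment_decreasing:
  assumes r: "r \<ge> 1"
  shows "log_gfact (Suc (Suc r)) - log_gfact (Suc r) < log_gfact (Suc r) - log_gfact r"
proof -
  define h where "h = r * ln (Suc r) - ln (fact r)"
  define x where "x = ln (Suc (Suc r)) - ln (Suc r)"
  define a where "a = real r"
  have a: "0 < a" "real (Suc r) = a + 1" "real (Suc (Suc r)) = a + 2" using r by (simp_all add: a_def)
  have x: "x < 1 / (a + 1)"
    using ln_Suc_diff_bounds(2)[of "Suc r"] unfolding x_def a by simp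
  have "ln (fact (Suc r) :: real) = ln (Suc r) + ln (fact r)"
    by (simp add: ln_mult)
  then have h': "Suc r * ln (Suc (Suc r)) - ln (fact (Suc r)) = h + (a + 1) * x"
    unfolding h_def x_def a a_def[symmetric] by (simp add: algebra_simps)
  have "(a + 1) * x < 1"
    using x a by (simp add: field_simps)
  then have "a * ((a + 1) * x) < a * 1"
    using a by (intro mult_strict_left_mono)
  also have "\<dots> \<le> 2 * h"
    using half_le_ln_fact_gap[of r] by (simp add: h_def a_def)
  finally have less: "a * (h + (a + 1) * x) < (a + 2) * h"
    by (simp add: algebra_simps)
  have "(h + (a + 1) * x) / ((a + 1) * (a + 2)) = (a * (h + (a + 1) * x)) / (a * ((a + 1) * (a + 2)))"
    using a by simp
  also have "\<dots> < ((a + 2) * h) / (a * ((a + 1) * (a + 2)))"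
    using a less by (intro divide_strict_right_mono mult_pos_pos) auto
  also have "\<dots> = h / (a * (a + 1))"
    using a by simp
  finally show ?thesis
    unfolding log_gfact_increment[OF r] log_gfact_increment[of "Suc r", OF le_SucI[OF r]] of_nat_mult
      a a_def[symmetric] h'[unfolded a] h_def[unfolded a a_def[symmetric], symmetric] .
qed

lemma log_gfact_increment_antimono:
  assumes "1 \<le> r" "r < s"
  shows "log_gfact (Suc s) - log_gfact s < log_gfact (Suc r) - log_gfact r"
  using assms(2)
proof (induction s)
  case (Suc s)
  then show ?case
    using log_gfact_increment_decreasing[of s] assms(1) by (cases "r = s") auto
qed simp

lemma log_gfact_strict_concave:
  assumes "t < m" "0 < t"
  shows "log_gfact (m - t) + log_gfact (m + t) < 2 * log_gfact m"
  using assms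
proof (induction t)
  case (Suc t)
  \<comment> \<open>Widening the pair by one loses the increment at \<open>m - Suc t\<close> and
    gains the smaller one at \<open>m + t\<close>.\<close>
  have "log_gfact (m - Suc t) + log_gfact (m + Suc t) < log_gfact (m - t) + log_gfact (m + t)"
    using log_gfact_increment_antimono[of "m - Suc t" "m + t"] Suc.prems
    by (simp add: Suc_diff_Suc) linarith
  also have "\<dots> \<le> 2 * log_gfact m"
    using Suc by (cases "t = 0") auto
  finally show ?case .
qed simp

lemma log_gfact_midpoint_less:
  assumes "0 < r" "r < 2 * m" "r \<noteq> m"
  shows "log_gfact r + log_gfact (2 * m - r) < 2 * log_gfact m"
proof (cases "r < m")
  case True
  have "m - (m - r) = r" "m + (m - r) = 2 * m - r" using True by linarith+
  then show ?thesis
    using log_gfact_strict_concave[of "m - r" m] assms True by simp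
next
  case False
  have eqs: "m - (r - m) = 2 * m - r" "m + (r - m) = r" and less: "r - m < m" "0 < r - m"
    using False assms by linarith+
  show ?thesis
    using log_gfact_strict_concave[OF less] unfolding eqs by (simp only: add.commute)
qed

lemma log_gfact_midpoint_le:
  assumes "0 < r" "r < 2 * m"
  shows "log_gfact r + log_gfact (2 * m - r) \<le> 2 * log_gfact m"
proof (cases "r = m")
  case True
  then have "2 * m - r = m" by simp
  then show ?thesis using True by simp
qed (use log_gfact_midpoint_less[OF assms] in simp)

section \<open>The product of the permanents of a matrix and its complement\<close>

lemma card_minus_inter:
  assumes "finite J"
  shows "card ((J - A) \<inter> J) = card J - card (A \<inter> J)"
proof -
  have "(J - A) \<inter> J = J - A \<inter> J" by auto
  then show ?thesis using assms by (simp add: card_Diff_subset)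
qed

lemma ln_num_matchings_complement_gap:
  fixes E :: "'a \<Rightarrow> 'b set"
  assumes fin: "finite I" "finite J" and card: "card I = 2 * m" "card J = 2 * m" "0 < m"
    and pos: "0 < num_matchings I J E" "0 < num_matchings I J (\<lambda>i. J - E i)"
  defines "defect \<equiv> \<lambda>i. 2 * log_gfact m - (log_gfact (card (E i \<inter> J)) + log_gfact (2 * m - card (E i \<inter> J)))"
  shows "4 * ln (fact m) - ln (real (num_matchings I J E * num_matchings I J (\<lambda>i. J - E i))) =
      bregman_gap I J E + bregman_gap I J (\<lambda>i. J - E i) + (\<Sum>i\<in>I. defect i)"
    and "\<And>i. i \<in> I \<Longrightarrow> 0 < card (E i \<inter> J) \<and> card (E i \<inter> J) < 2 * m"
proof -
  show "0 < card (E i \<inter> J) \<and> card (E i \<inter> J) < 2 * m" if "i \<in> I" for i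
  proof -
    have "0 < card (E i \<inter> J)"
      using num_matchings_row_nonempty[OF fin pos(1) that] fin by (simp add: card_gt_0_iff)
    moreover have "0 < card ((J - E i) \<inter> J)"
      using num_matchings_row_nonempty[OF fin pos(2) that] fin by (simp add: card_gt_0_iff)
    ultimately show ?thesis using card by (simp add: card_minus_inter[OF fin(2)])
  qed
  \<comment> \<open>There are \<open>2 * m\<close> rows, each with main term
    \<open>2 * log_gfact m\<close>, and \<open>m * log_gfact m\<close> is
    \<open>ln (fact m)\<close>.\<close>
  have "(\<Sum>i\<in>I. defect i) = 4 * (m * log_gfact m) -
      ((\<Sum>i\<in>I. log_gfact (card (E i \<inter> J))) + (\<Sum>i\<in>I. log_gfact (card ((J - E i) \<inter> J))))"
    using card by (simp add: defect_def sum_subtractf sum.distrib card_minus_inter[OF fin(2)])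
  then show "4 * ln (fact m) - ln (real (num_matchings I J E * num_matchings I J (\<lambda>i. J - E i))) =
      bregman_gap I J E + bregman_gap I J (\<lambda>i. J - E i) + (\<Sum>i\<in>I. defect i)"
    using pos by (simp add: bregman_gap_def mult_log_gfact ln_mult)
qed

lemma num_matchings_mult_complement_le:
  assumes fin: "finite I" "finite J" and card: "card I = 2 * m" "card J = 2 * m" "0 < m"
  shows "num_matchings I J E * num_matchings I J (\<lambda>i. J - E i) \<le> fact m ^ 4"
proof (cases "num_matchings I J E = 0 \<or> num_matchings I J (\<lambda>i. J - E i) = 0")
  case False
  let ?Q = "num_matchings I J E * num_matchings I J (\<lambda>i. J - E i)"
  have pos: "0 < num_matchings I J E" "0 < num_matchings I J (\<lambda>i. J - E i)" using False by auto
  note gap_sum = ln_num_matchings_complement_gap[OF fin card pos]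
  have "0 \<le> (\<Sum>i\<in>I. 2 * log_gfact m - (log_gfact (card (E i \<inter> J)) + log_gfact (2 * m - card (E i \<inter> J))))"
    using gap_sum(2) log_gfact_midpoint_le by (intro sum_nonneg) simp
  then have "ln (real ?Q) \<le> 4 * ln (fact m)"
    using gap_sum(1) bregman_gap_nonneg[OF fin pos(1)] bregman_gap_nonneg[OF fin pos(2)] by linarith
  also have "\<dots> = ln (real (fact m ^ 4))"
    by (simp add: ln_realpow)
  finally have "real ?Q \<le> real (fact m ^ 4)"
    using pos by (subst (asm) ln_le_cancel_iff) auto
  then show ?thesis by (simp only: of_nat_le_iff)
qed auto

lemma num_matchings_mult_complement_eqD:
  assumes fin: "finite I" "finite J" and card: "card I = 2 * m" "card J = 2 * m" "0 < m"
    and eq: "num_matchings I J E * num_matchings I J (\<lambda>i. J - E i) = fact m ^ 4"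
  obtains A C where "A \<subseteq> I" "card A = m" "C \<subseteq> J" "card C = m"
    "\<And>i. i \<in> A \<Longrightarrow> E i \<inter> J = C" "\<And>i. i \<in> I - A \<Longrightarrow> E i \<inter> J = J - C"
proof -
  have "0 < num_matchings I J E * num_matchings I J (\<lambda>i. J - E i)" unfolding eq by simp
  then have pos: "0 < num_matchings I J E" "0 < num_matchings I J (\<lambda>i. J - E i)" by auto
  note gap_sum = ln_num_matchings_complement_gap[OF fin card pos]
  define defect where
    "defect i = 2 * log_gfact m - (log_gfact (card (E i \<inter> J)) + log_gfact (2 * m - card (E i \<inter> J)))" for i
  have nonneg: "0 \<le> defect i" if "i \<in> I" for i
    using gap_sum(2)[OF that] log_gfact_midpoint_le by (simp add: defect_def)
  have "4 * ln (fact m) - ln (real (fact m ^ 4)) = 0"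
    by (simp add: ln_realpow)
  then have "bregman_gap I J E + bregman_gap I J (\<lambda>i. J - E i) + (\<Sum>i\<in>I. defect i) = 0"
    using gap_sum(1) unfolding eq defect_def by simp
  moreover have "0 \<le> (\<Sum>i\<in>I. defect i)" by (intro sum_nonneg nonneg)
  ultimately have gap: "bregman_gap I J E = 0" and sum: "(\<Sum>i\<in>I. defect i) = 0"
    using bregman_gap_nonneg[OF fin pos(1)] bregman_gap_nonneg[OF fin pos(2)] by linarith+
  have row_card: "card (E i \<inter> J) = m" if "i \<in> I" for i
  proof (rule ccontr)
    assume "card (E i \<inter> J) \<noteq> m"
    then have "0 < defect i"
      using gap_sum(2)[OF that] log_gfact_midpoint_less by (simp add: defect_def)
    moreover have "defect i = 0"
      using sum sum_nonneg_eq_0_iff[OF fin(1), of defect] nonneg that by auto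
    ultimately show False by simp
  qed
  obtain i0 where i0: "i0 \<in> I" using card fin by (cases "I = {}") auto
  define C where "C = E i0 \<inter> J"
  define A where "A = {i \<in> I. E i \<inter> J = C}"
  have C: "C \<subseteq> J" "card C = m" using row_card[OF i0] by (auto simp: C_def)
  have "card (J - C) = m" using C card fin by (simp add: card_Diff_subset finite_subset)
  \<comment> \<open>A row different from \<open>C\<close> is disjoint from it, and with
    \<open>m\<close> entries it must fill \<open>J - C\<close>.\<close>
  have other: "E i \<inter> J = J - C" if "i \<in> I - A" for i
  proof (rule card_subset_eq)
    have "E i0 \<inter> E i \<inter> J = {}"
      using bregman_equality_rows[OF fin pos(1) gap i0, of i] that by (auto simp: A_def C_def)
    then show "E i \<inter> J \<subseteq> J - C" by (auto simp: C_def)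
    show "card (E i \<inter> J) = card (J - C)"
      using \<open>card (J - C) = m\<close> row_card that by simp
  qed (use fin in simp)
  obtain f where f: "f \<in> matchings I J E"
    using pos(1) num_matchings_pos_iff[OF fin] by blast
  have inj: "inj_on f I" using matchingsD(2)[OF f] by (simp add: bij_betw_def)
  \<comment> \<open>A matching sends \<open>A\<close> into \<open>C\<close> and the other rows into
    \<open>J - C\<close>. Hence neither class has more than \<open>m\<close> of the
    \<open>2 * m\<close> rows.\<close>
  have "card A \<le> card C"
  proof (rule card_inj_on_le[where f = f])
    show "f ` A \<subseteq> C" using matchingsD(3,4)[OF f] by (auto simp: A_def)
  qed (use inj C fin in \<open>auto simp: A_def intro: inj_on_subset finite_subset\<close>)
  moreover have "card (I - A) \<le> card (J - C)"
  proof (rule card_inj_on_le[where f = f])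
    show "f ` (I - A) \<subseteq> J - C" using matchingsD(3,4)[OF f] other by blast
  qed (use inj fin in \<open>auto intro: inj_on_subset\<close>)
  moreover have "card (I - A) = 2 * m - card A"
    using fin card by (subst card_Diff_subset) (auto simp: A_def)
  ultimately have "card A = m"
    using C \<open>card (J - C) = m\<close> by simp
  show ?thesis
  proof (rule that)
    show "A \<subseteq> I" by (auto simp: A_def)
    show "E i \<inter> J = C" if "i \<in> A" for i using that by (simp add: A_def)
  qed fact+
qed

section \<open>Bipartite tournaments\<close>

text \<open>The permanent of the adjacency matrix without a numbering of the vertices. This makes it
  invariant under every isomorphism, including those that exchange the two parts.\<close>

definition cycle_covers :: "'a pair_pre_digraph \<Rightarrow> nat" where
  "cycle_covers D = num_matchings (pverts D) (pverts D) (\<lambda>u. {v. (u, v) \<in> parcs D})"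

lemma cycle_covers_iso:
  assumes fin: "finite (pverts D)" and iso: "digraph_iso (with_proj D) (with_proj D')"
  shows "cycle_covers D = cycle_covers D'"
proof -
  obtain h where h: "pre_digraph.digraph_isomorphism (with_proj D) h" "with_proj D' = app_iso h (with_proj D)"
    using iso unfolding digraph_iso_def by blast
  let ?v = "iso_verts h" and ?a = "iso_arcs h"
  have inj: "inj_on ?v (pverts D)" and wf: "wf_digraph (with_proj D)"
    and arcs: "\<And>e. e \<in> parcs D \<Longrightarrow> ?v (fst e) = iso_tail h (?a e) \<and> ?v (snd e) = iso_head h (?a e)"
    using h(1) unfolding pre_digraph.digraph_isomorphism_def by auto
  have "verts (with_proj D') = ?v ` pverts D" "arcs (with_proj D') = ?a ` parcs D"
    "tail (with_proj D') = iso_tail h" "head (with_proj D') = iso_head h"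
    unfolding h(2) by simp_all
  then have D': "pverts D' = ?v ` pverts D" "parcs D' = ?a ` parcs D"
    "iso_tail h = fst" "iso_head h = snd"
    by simp_all
  \<comment> \<open>An isomorphism carries its own arc map; since tails and heads are projections in
    both digraphs, the vertex map determines it.\<close>
  have arc_image: "?a (u, v) = (?v u, ?v v)" if "(u, v) \<in> parcs D" for u v
    using arcs[OF that] D'(3,4) by (simp add: prod_eq_iff)
  have verts: "u \<in> pverts D" "v \<in> pverts D" if "(u, v) \<in> parcs D" for u v
    using wf_digraph.wellformed[OF wf, of "(u, v)"] that by simp_all
  show ?thesis
    unfolding cycle_covers_def
  proof (rule num_matchings_reindex[OF fin fin, of ?v _ ?v])
    show "bij_betw ?v (pverts D) (pverts D')" "bij_betw ?v (pverts D) (pverts D')"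
      using inj D'(1) by (simp_all add: bij_betw_def)
    fix u v assume uv: "u \<in> pverts D" "v \<in> pverts D"
    have "(?v u, ?v v) \<in> parcs D' \<longleftrightarrow> (u, v) \<in> parcs D"
    proof
      assume "(?v u, ?v v) \<in> parcs D'"
      then obtain u' v' where uv': "(u', v') \<in> parcs D" "?v u = ?v u'" "?v v = ?v v'"
        using D'(2) arc_image by force
      then have "u = u'" "v = v'"
        using inj uv verts[OF uv'(1)] by (auto dest: inj_onD)
      then show "(u, v) \<in> parcs D" using uv'(1) by simp
    next
      assume "(u, v) \<in> parcs D"
      then show "(?v u, ?v v) \<in> parcs D'"
        using D'(2) arc_image[of u v] by (metis image_eqI)
    qed
    then show "v \<in> {v. (u, v) \<in> parcs D} \<longleftrightarrow> ?v v \<in> {v. (?v u, v) \<in> parcs D'}" by simp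
  qed
qed

lemma bij_betw_nth_vertex:
  "bij_betw (nth_vertex n) {0..<2 * n} (X ` {1..n} \<union> Y ` {1..n})"
proof (rule bij_betwI')
  show "nth_vertex n i = nth_vertex n j \<longleftrightarrow> i = j" for i j
    by (auto simp: nth_vertex_def)
  show "nth_vertex n i \<in> X ` {1..n} \<union> Y ` {1..n}" if "i \<in> {0..<2 * n}" for i
    using that by (auto simp: nth_vertex_def)
  show "\<exists>i\<in>{0..<2 * n}. v = nth_vertex n i" if v: "v \<in> X ` {1..n} \<union> Y ` {1..n}" for v
  proof (cases v)
    case (X k)
    then show ?thesis
      using v by (intro bexI[of _ "k - 1"]) (auto simp: nth_vertex_def)
  next
    case (Y k)
    then show ?thesis
      using v by (intro bexI[of _ "n + k - 1"]) (auto simp: nth_vertex_def)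
  qed
qed

lemma permanent_adjacency_matrix:
  assumes "pverts D = X ` {1..n} \<union> Y ` {1..n}"
  shows "permanent (adjacency_matrix n D) = cycle_covers D"
proof -
  have "permanent (adjacency_matrix n D) =
      num_matchings {0..<2 * n} {0..<2 * n} (\<lambda>i. {j. (nth_vertex n i, nth_vertex n j) \<in> parcs D})"
    unfolding adjacency_matrix_def by (subst permanent_eq_num_matchings[symmetric]) simp
  also have "\<dots> = cycle_covers D"
    unfolding cycle_covers_def assms
    by (rule num_matchings_reindex[OF _ _ bij_betw_nth_vertex bij_betw_nth_vertex]) simp_all
  finally show ?thesis .
qed

lemma bipartite_tournamentsD:
  assumes "D \<in> bipartite_tournaments n"
  shows "pverts D = X ` {1..n} \<union> Y ` {1..n}"
    and "(u, v) \<in> parcs D \<Longrightarrow> (u \<in> X ` {1..n} \<and> v \<in> Y ` {1..n}) \<or> (u \<in> Y ` {1..n} \<and> v \<in> X ` {1..n})"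
    and "u \<in> X ` {1..n} \<Longrightarrow> v \<in> Y ` {1..n} \<Longrightarrow> (v, u) \<in> parcs D \<longleftrightarrow> (u, v) \<notin> parcs D"
proof -
  have sub: "parcs D \<subseteq> X ` {1..n} \<times> Y ` {1..n} \<union> Y ` {1..n} \<times> X ` {1..n}"
    and pv: "pverts D = X ` {1..n} \<union> Y ` {1..n}"
    and orient: "\<And>u v. (u, v) \<in> parcs (complete_bipartite n) \<Longrightarrow> (u, v) \<in> parcs D \<longleftrightarrow> (v, u) \<notin> parcs D"
    using assms unfolding bipartite_tournaments_def orientation_def
    by (auto simp only: mem_Collect_eq complete_bipartite_def pair_pre_digraph.simps)
  show "pverts D = X ` {1..n} \<union> Y ` {1..n}" by (rule pv)
  show "(u \<in> X ` {1..n} \<and> v \<in> Y ` {1..n}) \<or> (u \<in> Y ` {1..n} \<and> v \<in> X ` {1..n})"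
    if "(u, v) \<in> parcs D"
    using subsetD[OF sub that] by simp
  show "(v, u) \<in> parcs D \<longleftrightarrow> (u, v) \<notin> parcs D" if "u \<in> X ` {1..n}" "v \<in> Y ` {1..n}"
    using orient[of v u] that by (simp only: complete_bipartite_def pair_pre_digraph.simps) blast
qed

lemma cycle_covers_bipartite_tournament:
  assumes D: "D \<in> bipartite_tournaments n"
  defines "out \<equiv> \<lambda>u. {v. (u, v) \<in> parcs D}"
  shows "cycle_covers D = num_matchings (X ` {1..n}) (Y ` {1..n}) out *
    num_matchings (X ` {1..n}) (Y ` {1..n}) (\<lambda>u. Y ` {1..n} - out u)"
proof -
  let ?X = "X ` {1..n}" and ?Y = "Y ` {1..n}"
  note D = bipartite_tournamentsD[OF D]
  have XY: "?X \<inter> ?Y = {}" by auto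
  \<comment> \<open>The columns are listed with \<open>?Y\<close> first: all arcs join different
    parts, so the matrix becomes block diagonal.\<close>
  have "cycle_covers D = num_matchings (?X \<union> ?Y) (?Y \<union> ?X) out"
    by (simp add: cycle_covers_def D(1) out_def Un_commute)
  also have "\<dots> = num_matchings ?X ?Y out * num_matchings ?Y ?X out"
    using XY D(2) unfolding out_def by (intro num_matchings_Un) blast+
  also have "num_matchings ?Y ?X out = num_matchings ?X ?Y (\<lambda>u. {v. u \<in> out v})"
    by (rule num_matchings_transpose) simp_all
  \<comment> \<open>Each edge keeps exactly one direction, so the transposed block from
    \<open>?Y\<close> to \<open>?X\<close> is the complement of the block from \<open>?X\<close> to
    \<open>?Y\<close>.\<close>
  also have "\<dots> = num_matchings ?X ?Y (\<lambda>u. ?Y - out u)"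
    by (rule num_matchings_cong) (use D(3) in \<open>simp add: out_def\<close>)
  finally show ?thesis .
qed

lemma cycle_covers_BT0:
  assumes n: "n = 2 * m"
  shows "cycle_covers (BT0 n) = fact m ^ 4"
proof -
  define A where "A = {1..m}"
  define B where "B = {Suc m..n}"
  have AB: "{1..n} = A \<union> B" "A \<inter> B = {}" using n by (auto simp: A_def B_def)
  have [simp]: "finite A" "finite B" by (simp_all add: A_def B_def)
  have card: "card (X ` A) = m" "card (X ` B) = m" "card (Y ` A) = m" "card (Y ` B) = m"
    using n by (simp_all add: A_def B_def card_image inj_on_def)
  let ?out = "\<lambda>u. {v. (u, v) \<in> parcs (BT0 n)}"
  have arcs: "parcs (BT0 n) = X ` A \<times> Y ` A \<union> X ` B \<times> Y ` B \<union> Y ` A \<times> X ` B \<union> Y ` B \<times> X ` A"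
    using n by (simp add: BT0_def Let_def A_def B_def)
  have out: "?out (X i) = (if i \<in> A then Y ` A else {}) \<union> (if i \<in> B then Y ` B else {})"
    "?out (Y i) = (if i \<in> A then X ` B else {}) \<union> (if i \<in> B then X ` A else {})" for i
    using AB(2) unfolding arcs by auto
  have disj: "X ` A \<inter> X ` B = {}" "Y ` A \<inter> Y ` B = {}" "Y ` B \<inter> Y ` A = {}"
    "(X ` A \<union> X ` B) \<inter> (Y ` A \<union> Y ` B) = {}"
    using AB(2) by auto
  \<comment> \<open>Rows and columns are listed in matching orders, which exposes four complete
    \<open>m\<close> by \<open>m\<close> blocks.\<close>
  have pv: "pverts (BT0 n) = (X ` A \<union> X ` B) \<union> (Y ` B \<union> Y ` A)"
    "pverts (BT0 n) = (Y ` A \<union> Y ` B) \<union> (X ` A \<union> X ` B)"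
    unfolding BT0_def Let_def AB(1) by auto
  have "cycle_covers (BT0 n) =
      num_matchings ((X ` A \<union> X ` B) \<union> (Y ` B \<union> Y ` A)) ((Y ` A \<union> Y ` B) \<union> (X ` A \<union> X ` B)) ?out"
    unfolding cycle_covers_def using pv by simp
  also have "\<dots> = num_matchings (X ` A \<union> X ` B) (Y ` A \<union> Y ` B) ?out *
      num_matchings (Y ` B \<union> Y ` A) (X ` A \<union> X ` B) ?out"
    by (rule num_matchings_Un) (use disj in \<open>auto simp: arcs\<close>)
  also have "num_matchings (X ` A \<union> X ` B) (Y ` A \<union> Y ` B) ?out =
      num_matchings (X ` A) (Y ` A) ?out * num_matchings (X ` B) (Y ` B) ?out"
    by (rule num_matchings_Un) (use disj in \<open>auto simp: arcs\<close>)
  also have "num_matchings (Y ` B \<union> Y ` A) (X ` A \<union> X ` B) ?out =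
      num_matchings (Y ` B) (X ` A) ?out * num_matchings (Y ` A) (X ` B) ?out"
    by (rule num_matchings_Un) (use disj in \<open>auto simp: arcs\<close>)
  also have "num_matchings (X ` A) (Y ` A) ?out = fact m"
    by (subst num_matchings_complete) (auto simp: card arcs)
  also have "num_matchings (X ` B) (Y ` B) ?out = fact m"
    by (subst num_matchings_complete) (auto simp: card arcs)
  also have "num_matchings (Y ` B) (X ` A) ?out = fact m"
    by (subst num_matchings_complete) (auto simp: card arcs)
  also have "num_matchings (Y ` A) (X ` B) ?out = fact m"
    by (subst num_matchings_complete) (auto simp: card arcs)
  finally show ?thesis by (simp add: power4_eq_xxxx mult.assoc)
qed

text \<open>Preserving arcs in one direction suffices for tournaments: if a pair of the two parts is
  not an arc of \<open>D\<close>, its reverse is, and the image of the reverse excludes the image of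
  the pair.\<close>

lemma digraph_iso_if_bij:
  assumes D: "D \<in> bipartite_tournaments n" and D': "D' \<in> bipartite_tournaments n"
    and X: "bij_betw h (X ` {1..n}) (X ` {1..n})" and Y: "bij_betw h (Y ` {1..n}) (Y ` {1..n})"
    and arc: "\<And>u v. (u, v) \<in> parcs D \<Longrightarrow> (h u, h v) \<in> parcs D'"
  shows "digraph_iso (with_proj D) (with_proj D')"
proof -
  let ?X = "X ` {1..n}" and ?Y = "Y ` {1..n}"
  note D = bipartite_tournamentsD[OF D] and D' = bipartite_tournamentsD[OF D']
  have bij: "bij_betw h (pverts D) (pverts D')"
    unfolding D(1) D'(1) using X Y by (rule bij_betw_combine) auto
  have wf: "wf_digraph (with_proj D)"
    by unfold_locales (use D(1,2) in \<open>force+\<close>)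
  let ?h = "\<lparr>iso_verts = h, iso_arcs = map_prod h h, iso_head = snd, iso_tail = fst\<rparr>"
  have "parcs D' \<subseteq> map_prod h h ` parcs D"
  proof clarify
    fix a b assume ab: "(a, b) \<in> parcs D'"
    show "(a, b) \<in> map_prod h h ` parcs D"
    proof (cases "a \<in> ?X")
      case True
      then have "b \<in> ?Y" using D'(2)[OF ab] by auto
      then obtain u v where uv: "u \<in> ?X" "v \<in> ?Y" "a = h u" "b = h v"
        using True bij_betw_imp_surj_on[OF X] bij_betw_imp_surj_on[OF Y] by (metis imageE)
      then have "(v, u) \<notin> parcs D"
        using arc[of v u] D'(3)[of a b] True \<open>b \<in> ?Y\<close> ab by auto
      then have "(u, v) \<in> parcs D"
        using D(3)[OF uv(1,2)] by simp
      then show ?thesis unfolding uv(3,4) by (rule rev_image_eqI) simp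
    next
      case False
      then have "a \<in> ?Y" "b \<in> ?X" using D'(2)[OF ab] by auto
      then obtain u v where uv: "u \<in> ?Y" "v \<in> ?X" "a = h u" "b = h v"
        using bij_betw_imp_surj_on[OF X] bij_betw_imp_surj_on[OF Y] by (metis imageE)
      then have "(v, u) \<notin> parcs D"
        using arc[of v u] D'(3)[of b a] \<open>a \<in> ?Y\<close> \<open>b \<in> ?X\<close> ab by auto
      then have "(u, v) \<in> parcs D"
        using D(3)[OF uv(2,1)] by simp
      then show ?thesis unfolding uv(3,4) by (rule rev_image_eqI) simp
    qed
  qed
  then have parcs: "map_prod h h ` parcs D = parcs D'"
    using arc by auto
  have "inj_on (map_prod h h) (parcs D)"
  proof (rule inj_on_subset)
    show "inj_on (map_prod h h) (pverts D \<times> pverts D)"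
      using bij by (intro map_prod_inj_on) (simp_all add: bij_betw_def)
    show "parcs D \<subseteq> pverts D \<times> pverts D"
    proof (rule subrelI)
      fix u v assume "(u, v) \<in> parcs D"
      from D(2)[OF this] show "(u, v) \<in> pverts D \<times> pverts D" unfolding D(1) by blast
    qed
  qed
  then have "pre_digraph.digraph_isomorphism (with_proj D) ?h"
    using bij wf by (auto simp: pre_digraph.digraph_isomorphism_def bij_betw_def)
  moreover have "with_proj D' = app_iso ?h (with_proj D)"
    using bij parcs by (simp add: app_iso_def with_proj_def bij_betw_def)
  ultimately show ?thesis unfolding digraph_iso_def by blast
qed

section \<open>Recognising the extremal tournament\<close>

lemma bij_betw_two_blocks:
  assumes "finite S" "A \<subseteq> S" "card S = card T" "finite T" "A' \<subseteq> T" "card A = card A'"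
  obtains h where "bij_betw h S T" "\<And>x. x \<in> S \<Longrightarrow> h x \<in> A' \<longleftrightarrow> x \<in> A"
proof -
  have fin: "finite A" "finite A'" using assms finite_subset by auto
  obtain f where f: "bij_betw f A A'"
    using finite_same_card_bij[OF fin assms(6)] by blast
  have "card (S - A) = card (T - A')"
    using assms fin by (simp add: card_Diff_subset)
  then obtain g where g: "bij_betw g (S - A) (T - A')"
    using finite_same_card_bij[of "S - A" "T - A'"] assms by auto
  let ?h = "\<lambda>x. if x \<in> A then f x else g x"
  have "bij_betw ?h A A'"
    by (rule bij_betw_cong[THEN iffD1, OF _ f]) simp
  moreover have "bij_betw ?h (S - A) (T - A')"
    by (rule bij_betw_cong[THEN iffD1, OF _ g]) simp
  ultimately have "bij_betw ?h (A \<union> (S - A)) (A' \<union> (T - A'))"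
    by (rule bij_betw_combine) auto
  moreover have "A \<union> (S - A) = S" "A' \<union> (T - A') = T" using assms by auto
  ultimately have bij: "bij_betw ?h S T" by simp
  show ?thesis
  proof (rule that[OF bij])
    show "?h x \<in> A' \<longleftrightarrow> x \<in> A" if "x \<in> S" for x
      using that f g by (auto simp: bij_betw_def)
  qed
qed

lemma cycle_covers_bipartite_tournament_le:
  assumes "D \<in> bipartite_tournaments (2 * m)" "0 < m"
  shows "cycle_covers D \<le> fact m ^ 4"
  unfolding cycle_covers_bipartite_tournament[OF assms(1)]
  using assms(2) by (intro num_matchings_mult_complement_le) (simp_all add: card_image inj_on_def)

text \<open>The equality case gives blocks \<open>A\<close> and \<open>C\<close> of size
  \<open>m\<close>. Relabel each part separately so that its block becomes the first half.\<close>

lemma digraph_iso_BT0_if_extremal: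
  assumes D: "D \<in> bipartite_tournaments (2 * m)" and m: "0 < m" and eq: "cycle_covers D = fact m ^ 4"
  shows "digraph_iso (with_proj D) (with_proj (BT0 (2 * m)))"
proof -
  let ?n = "2 * m"
  let ?X = "X ` {1..?n}" and ?Y = "Y ` {1..?n}" and ?out = "\<lambda>u. {v. (u, v) \<in> parcs D}"
  have card: "card ?X = 2 * m" "card ?Y = 2 * m" by (simp_all add: card_image inj_on_def)
  obtain A C where A: "A \<subseteq> ?X" "card A = m" and C: "C \<subseteq> ?Y" "card C = m"
    and outA: "\<And>u. u \<in> A \<Longrightarrow> ?out u \<inter> ?Y = C" and outB: "\<And>u. u \<in> ?X - A \<Longrightarrow> ?out u \<inter> ?Y = ?Y - C"
    using num_matchings_mult_complement_eqD[OF _ _ card m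
        eq[unfolded cycle_covers_bipartite_tournament[OF D]]] by auto
  have sub: "X ` {1..m} \<subseteq> ?X" "Y ` {1..m} \<subseteq> ?Y" by auto
  have cards: "card A = card (X ` {1..m})" "card C = card (Y ` {1..m})"
    using A C by (simp_all add: card_image inj_on_def)
  obtain f where f: "bij_betw f ?X ?X" "\<And>x. x \<in> ?X \<Longrightarrow> f x \<in> X ` {1..m} \<longleftrightarrow> x \<in> A"
    using bij_betw_two_blocks[OF _ A(1) refl _ sub(1) cards(1)] by auto
  obtain g where g: "bij_betw g ?Y ?Y" "\<And>y. y \<in> ?Y \<Longrightarrow> g y \<in> Y ` {1..m} \<longleftrightarrow> y \<in> C"
    using bij_betw_two_blocks[OF _ C(1) refl _ sub(2) cards(2)] by auto
  define h where "h v = (if v \<in> ?X then f v else g v)" for v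
  have hX: "bij_betw h ?X ?X"
    by (rule bij_betw_cong[THEN iffD1, OF _ f(1)]) (simp add: h_def)
  have hY: "bij_betw h ?Y ?Y"
    by (rule bij_betw_cong[THEN iffD1, OF _ g(1)]) (auto simp: h_def)
  have "{m + 1..?n} = {1..?n} - {1..m}" by auto
  moreover have "inj X" "inj Y" by (simp_all add: inj_def)
  ultimately have halves: "X ` {m + 1..?n} = ?X - X ` {1..m}" "Y ` {m + 1..?n} = ?Y - Y ` {1..m}"
    by (simp_all only: image_set_diff)
  have hA: "(if x \<in> A then h x \<in> X ` {1..m} else h x \<in> X ` {m + 1..?n})" if "x \<in> ?X" for x
    using f(2)[OF that] bij_betwE[OF f(1), rule_format, OF that] that unfolding halves h_def by simp
  have hC: "(if y \<in> C then h y \<in> Y ` {1..m} else h y \<in> Y ` {m + 1..?n})" if "y \<in> ?Y" for y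
  proof -
    have "y \<notin> ?X" using that by auto
    then show ?thesis
      using g(2)[OF that] bij_betwE[OF g(1), rule_format, OF that] that unfolding halves h_def by simp
  qed
  \<comment> \<open>This is the rule defining \<open>BT0\<close>: an edge points from
    \<open>X\<close> to \<open>Y\<close> exactly if its ends lie in corresponding halves.\<close>
  have arcs: "(u, v) \<in> parcs D \<longleftrightarrow> (u \<in> A \<longleftrightarrow> v \<in> C)" if "u \<in> ?X" "v \<in> ?Y" for u v
    using outA[of u] outB[of u] that by (cases "u \<in> A") auto
  show ?thesis
  proof (rule digraph_iso_if_bij[OF D BT0_in_bipartite_tournaments hX hY])
    fix u v assume uv: "(u, v) \<in> parcs D"
    from bipartite_tournamentsD(2)[OF D uv] show "(h u, h v) \<in> parcs (BT0 ?n)"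
    proof (elim disjE conjE)
      assume "u \<in> ?X" "v \<in> ?Y"
      then show ?thesis
        using arcs[of u v] uv hA[of u] hC[of v] by (auto simp: BT0_def Let_def split: if_splits)
    next
      assume vu: "u \<in> ?Y" "v \<in> ?X"
      then have "(v, u) \<notin> parcs D" using bipartite_tournamentsD(3)[OF D] uv by auto
      then show ?thesis
        using arcs[of v u] vu hA[of v] hC[of u] by (auto simp: BT0_def Let_def split: if_splits)
    qed
  qed
qed

theorem theorem9:
  fixes n :: nat
  assumes "n > 0" and "even n"
  shows "rho n = (fact (n div 2)) ^ 4 \<and>
    (\<forall>BT \<in> bipartite_tournaments n.
       permanent (adjacency_matrix n BT) = rho n \<longleftrightarrow>
       digraph_iso (with_proj BT) (with_proj (BT0 n)))"
proof -
  define m where "m = n div 2"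
  have n: "n = 2 * m" and m: "0 < m" using assms by (auto simp: m_def)
  have per: "permanent (adjacency_matrix n D) = cycle_covers D" if "D \<in> bipartite_tournaments n" for D
    by (rule permanent_adjacency_matrix[OF bipartite_tournamentsD(1)[OF that]])
  have "rho n = Max (cycle_covers ` bipartite_tournaments n)"
    unfolding rho_def using per by (simp cong: image_cong)
  also have "\<dots> = fact m ^ 4"
  proof (rule Max_eqI)
    show "finite (cycle_covers ` bipartite_tournaments n)"
      using finite_bipartite_tournaments by blast
    show "k \<le> fact m ^ 4" if "k \<in> cycle_covers ` bipartite_tournaments n" for k
      using that cycle_covers_bipartite_tournament_le m unfolding n by blast
    show "fact m ^ 4 \<in> cycle_covers ` bipartite_tournaments n"
      using cycle_covers_BT0[OF n] BT0_in_bipartite_tournaments by (metis image_eqI)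
  qed
  finally have rho: "rho n = fact m ^ 4" .
  have "cycle_covers D = fact m ^ 4 \<longleftrightarrow> digraph_iso (with_proj D) (with_proj (BT0 n))"
    if D: "D \<in> bipartite_tournaments n" for D
  proof
    assume "cycle_covers D = fact m ^ 4"
    then show "digraph_iso (with_proj D) (with_proj (BT0 n))"
      using digraph_iso_BT0_if_extremal[OF D[unfolded n] m] n by simp
  next
    assume "digraph_iso (with_proj D) (with_proj (BT0 n))"
    then show "cycle_covers D = fact m ^ 4"
      using cycle_covers_iso[of D "BT0 n"] cycle_covers_BT0[OF n] bipartite_tournamentsD(1)[OF D] by simp
  qed
  then show ?thesis using rho per by (simp add: m_def)
qed

end
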